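(* Let $l_1,l,c,k$ be constants and let $$Q(w,x_1,x_2)=(x_1-x_2)^2w^2-2R(x_1,x_2)w-R_1(x_1,x_2),$$ $$R(x_1,x_2)=-x_1^2x_2^2+6l_1x_1x_2+2lc(x_1+x_2)+c^2-k^2,$$ $$R_1(x_1,x_2)=-6l_1x_1^2x_2^2-(c^2-k^2)(x_1+x_2)^2-4clx_1x_2(x_1+x_2)+6l_1(c^2-k^2)-4c^2l^2.$$ Then the Kowalevski fundamental equation $Q(w,x_1,x_2)=0$ is the point equation of the pencil of conics $\hat C_1+wC_2$, where $\hat C_1$ and $C_2$ are given by the tangential equations $$\hat C_1:\ -2w_1^2+3l_1w_2^2+2(c^2-k^2)w_3^2-4cl\,w_2w_3=0,\qquad C_2:\ w_2^2-4w_1w_3=0,$$ with $w$ the pencil parameter and $x_1,x_2$ the Darboux coordinates with respect to $C_2$. Explicitly, $$Q(w,x_1,x_2)=\det\begin{pmatrix}0&z_1&z_2&z_3\\ z_1&-2&0&-2w\\ z_2&0&3l_1+w&-2cl\\ z_3&-2w&-2cl&2(c^2-k^2)\end{pmatrix},\qquad z_1=1,\ z_2=\frac{x_1+x_2}{2},\ z_3=x_1x_2 .$$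
   Context: For a conic with tangential (dual) equation $\sum A_{ij}w_iw_j=0$, $A$ a symmetric $3\times 3$ matrix, the point equation is $\det\begin{pmatrix}0&z^T\\ z&A\end{pmatrix}=0$, $z=(z_1,z_2,z_3)^T$. The Darboux coordinates of a point $(z_1:z_2:z_3)$ with respect to $C_2$ are the two roots $x_1,x_2$ of $z_1\ell^2-2z_2\ell+z_3=0$ (the parameters of the two tangents to $C_2$ through the point), so that with $z_1=1$ one has $z_2=(x_1+x_2)/2$, $z_3=x_1x_2$. *)

theory Defs
  imports
    "HOL-Analysis.Analysis"
    "HOL-Computational_Algebra.Polynomial"
begin

text \<open>Conics in the complex projective plane are given by symmetric matrices. A vector
  (w1, w2, w3) stands for the line w1 z1 + w2 z2 + w3 z3 = 0.\<close>

definition tangential_form :: "complex^3^3 \<Rightarrow> complex^3 \<Rightarrow> complex" where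
  "tangential_form A v = (\<Sum>i\<in>UNIV. \<Sum>j\<in>UNIV. A $ i $ j * v $ i * v $ j)"

text \<open>The bordered determinant; the point equation of the conic is that it vanishes.
  The conic may be degenerate.\<close>

definition point_form :: "complex^3^3 \<Rightarrow> complex^3 \<Rightarrow> complex" where
  "point_form A z = det (vector
     [vector [0,     z $ 1,     z $ 2,     z $ 3],
      vector [z $ 1, A $ 1 $ 1, A $ 1 $ 2, A $ 1 $ 3],
      vector [z $ 2, A $ 2 $ 1, A $ 2 $ 2, A $ 2 $ 3],
      vector [z $ 3, A $ 3 $ 1, A $ 3 $ 2, A $ 3 $ 3]] :: complex^4^4)"

definition pencil :: "complex^3^3 \<Rightarrow> complex^3^3 \<Rightarrow> complex \<Rightarrow> complex^3^3" where
  "pencil A B w = (\<chi> i j. A $ i $ j + w * B $ i $ j)"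

definition C1_hat :: "complex \<Rightarrow> complex \<Rightarrow> complex \<Rightarrow> complex \<Rightarrow> complex^3^3" where
  "C1_hat l1 l c k = vector
     [vector [-2, 0, 0],
      vector [0, 3 * l1, - 2 * c * l],
      vector [0, - 2 * c * l, 2 * (c\<^sup>2 - k\<^sup>2)]]"

definition C2 :: "complex^3^3" where
  "C2 = vector
     [vector [0, 0, -2],
      vector [0, 1, 0],
      vector [-2, 0, 0]]"

text \<open>The two roots are counted with multiplicity. Hence \<open>z $ 1 \<noteq> 0\<close>: points with
  \<open>z $ 1 = 0\<close> lie on the tangent with parameter infinity and have no finite pair of
  Darboux coordinates.\<close>

definition darboux_coords :: "complex^3 \<Rightarrow> complex \<Rightarrow> complex \<Rightarrow> bool" where
  "darboux_coords z x1 x2 \<longleftrightarrow> proots [: z $ 3, - 2 * z $ 2, z $ 1 :] = {#x1, x2#}"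

definition C2_tangent :: "complex \<Rightarrow> complex^3" where
  "C2_tangent t = vector [t\<^sup>2, - 2 * t, 1]"

lemma tangential_form_C2_tangent: "tangential_form C2 (C2_tangent t) = 0"
  by (simp add: tangential_form_def C2_def C2_tangent_def sum_3 power2_eq_square)

lemma C2_tangent_incidence:
  "(\<Sum>i\<in>UNIV. C2_tangent t $ i * z $ i) = poly [: z $ 3, - 2 * z $ 2, z $ 1 :] t"
  by (simp add: C2_tangent_def sum_3 power2_eq_square algebra_simps)

definition kow_R ::
  "complex \<Rightarrow> complex \<Rightarrow> complex \<Rightarrow> complex \<Rightarrow> complex \<Rightarrow> complex \<Rightarrow> complex" where
  "kow_R l1 l c k x1 x2 =
     - (x1\<^sup>2 * x2\<^sup>2) + 6 * l1 * x1 * x2 + 2 * l * c * (x1 + x2) + c\<^sup>2 - k\<^sup>2"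

definition kow_R1 ::
  "complex \<Rightarrow> complex \<Rightarrow> complex \<Rightarrow> complex \<Rightarrow> complex \<Rightarrow> complex \<Rightarrow> complex" where
  "kow_R1 l1 l c k x1 x2 =
     - 6 * l1 * x1\<^sup>2 * x2\<^sup>2 - (c\<^sup>2 - k\<^sup>2) * (x1 + x2)\<^sup>2
     - 4 * c * l * x1 * x2 * (x1 + x2) + 6 * l1 * (c\<^sup>2 - k\<^sup>2) - 4 * c\<^sup>2 * l\<^sup>2"

definition kow_Q ::
  "complex \<Rightarrow> complex \<Rightarrow> complex \<Rightarrow> complex \<Rightarrow> complex \<Rightarrow> complex \<Rightarrow> complex \<Rightarrow> complex" where
  "kow_Q l1 l c k w x1 x2 =
     (x1 - x2)\<^sup>2 * w\<^sup>2 - 2 * kow_R l1 l c k x1 x2 * w - kow_R1 l1 l c k x1 x2"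

end

theory Submission
  imports Defs "HOL-Computational_Algebra.Fundamental_Theorem_Algebra"
begin

text \<open>The theorem rests on three computations.

  By Vieta, the roots \<open>x1\<close>, \<open>x2\<close> of the quadratic with coefficients \<open>z $ 1\<close>,
  \<open>- 2 * z $ 2\<close>, \<open>z $ 3\<close> satisfy \<open>z $ 2 = z $ 1 * (x1 + x2) / 2\<close> and
  \<open>z $ 3 = z $ 1 * (x1 * x2)\<close> with \<open>z $ 1 \<noteq> 0\<close>, and these equations characterise
  them (lemma \<open>darboux_coords_iff\<close>).

  The bordered determinant of a matrix is minus the quadratic form of its cofactors
  (lemma \<open>det_bordered\<close>). For the pencil, this is a quadratic polynomial in the pencil
  parameter \<open>w\<close>. Its leading coefficient is \<open>4 * (z $ 2)\<^sup>2 - 4 * z $ 1 * z $ 3\<close>, which is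
  the point form of \<open>C2\<close> alone and also the discriminant of the quadratic above, hence
  \<open>(z $ 1)\<^sup>2 * (x1 - x2)\<^sup>2\<close>. The other two coefficients are \<open>- 2 * kow_R\<close> and \<open>- kow_R1\<close>, again
  up to the factor \<open>(z $ 1)\<^sup>2\<close>.

  So \<open>point_form\<close> is \<open>(z $ 1)\<^sup>2 * kow_Q\<close> (lemma \<open>point_form_pencil\<close>). The factor is nonzero, so
  the two vanish together, and it is \<open>1\<close> when \<open>z $ 1 = 1\<close>.\<close>

lemma vector_4:
  "(vector [a, b, c, d] :: ('a::zero)^4) $ 1 = a"
  "(vector [a, b, c, d] :: ('a::zero)^4) $ 2 = b"
  "(vector [a, b, c, d] :: ('a::zero)^4) $ 3 = c"
  "(vector [a, b, c, d] :: ('a::zero)^4) $ 4 = d"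
  unfolding vector_def by simp_all

text \<open>Expanding along the border row and then along the border column pairs each
  \<open>z\<^sub>i * z\<^sub>j\<close> with the cofactor of the \<open>(i, j)\<close> entry, with one common sign.\<close>

lemma det_bordered:
  fixes z1 z2 z3 :: "'a::comm_ring_1"
  shows "det (vector
     [vector [0, z1, z2, z3],
      vector [z1, a11, a12, a13],
      vector [z2, a21, a22, a23],
      vector [z3, a31, a32, a33]] :: 'a^4^4) =
    - (z1 * z1 * (a22 * a33 - a23 * a32) - z1 * z2 * (a21 * a33 - a23 * a31)
       + z1 * z3 * (a21 * a32 - a22 * a31)
       - z2 * z1 * (a12 * a33 - a13 * a32) + z2 * z2 * (a11 * a33 - a13 * a31)
       - z2 * z3 * (a11 * a32 - a12 * a31)
       + z3 * z1 * (a12 * a23 - a13 * a22) - z3 * z2 * (a11 * a23 - a13 * a21)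
       + z3 * z3 * (a11 * a22 - a12 * a21))"
proof -
  have fin: "finite {2::4, 3, 4}" "finite {3::4, 4}" "finite {4::4}"
    by simp_all
  have notin: "(1::4) \<notin> {2, 3, 4}" "(2::4) \<notin> {3, 4}" "(3::4) \<notin> {4}"
    by simp_all
  show ?thesis
    unfolding det_def UNIV_4
    unfolding sum_over_permutations_insert[OF fin(1) notin(1)]
    unfolding sum_over_permutations_insert[OF fin(2) notin(2)]
    unfolding sum_over_permutations_insert[OF fin(3) notin(3)]
    unfolding permutes_sing
    by (simp add: sign_swap_id sign_compose permutation_swap_id sign_id vector_4
        permutation_compose algebra_simps Transposition.transpose_def)
qed

lemma darboux_coords_iff:
  "darboux_coords z x1 x2 \<longleftrightarrow>
     z $ 1 \<noteq> 0 \<and> z $ 2 = z $ 1 * (x1 + x2) / 2 \<and> z $ 3 = z $ 1 * (x1 * x2)"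
proof
  let ?p = "[: z $ 3, - 2 * z $ 2, z $ 1 :]"
  assume "darboux_coords z x1 x2"
  then have roots: "proots ?p = {#x1, x2#}"
    by (simp add: darboux_coords_def)
  \<comment> \<open>There are as many roots as the degree, so the leading coefficient does not vanish.\<close>
  have "degree ?p = 2"
    using size_proots_complex[of ?p] roots by simp
  then have z1: "z $ 1 \<noteq> 0"
    by (auto split: if_splits)
  have "?p = smult (z $ 1) ([:- x1, 1:] * [:- x2, 1:])"
    using complex_poly_decompose_multiset[of ?p, unfolded roots] z1
    by (simp add: algebra_simps)
  then show "z $ 1 \<noteq> 0 \<and> z $ 2 = z $ 1 * (x1 + x2) / 2 \<and> z $ 3 = z $ 1 * (x1 * x2)"
    using z1 by (simp add: field_simps)
next
  assume vieta: "z $ 1 \<noteq> 0 \<and> z $ 2 = z $ 1 * (x1 + x2) / 2 \<and> z $ 3 = z $ 1 * (x1 * x2)"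
  then have factored:
    "[: z $ 3, - 2 * z $ 2, z $ 1 :] = smult (z $ 1) ([:- x1, 1:] * [:- x2, 1:])"
    by (simp add: algebra_simps)
  have "proots ([:- x1, 1:] * [:- x2, 1:]) = {#x1, x2#}"
    by (subst proots_mult) simp_all
  then show "darboux_coords z x1 x2"
    unfolding darboux_coords_def factored using vieta by (simp only: proots_smult not_False_eq_True)
qed

text \<open>The point equation is homogeneous of degree two in \<open>z\<close>, which accounts for the
  factor \<open>(z $ 1)\<^sup>2\<close>: the Darboux coordinates depend on the projective point only.\<close>

lemma point_form_pencil:
  assumes "darboux_coords z x1 x2"
  shows "point_form (pencil (C1_hat l1 l c k) C2 w) z = (z $ 1)\<^sup>2 * kow_Q l1 l c k w x1 x2"
proof -
  have vieta: "z $ 2 = z $ 1 * (x1 + x2) / 2" "z $ 3 = z $ 1 * (x1 * x2)"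
    using assms by (simp_all add: darboux_coords_iff)
  show ?thesis
    by (simp add: point_form_def pencil_def C1_hat_def C2_def det_bordered vieta
        kow_Q_def kow_R_def kow_R1_def field_simps power2_eq_square)
qed

lemma transpose_C1_hat: "transpose (C1_hat l1 l c k) = C1_hat l1 l c k"
  by (simp add: vec_eq_iff forall_3 Finite_Cartesian_Product.transpose_def C1_hat_def)

lemma transpose_C2: "transpose C2 = C2"
  by (simp add: vec_eq_iff forall_3 Finite_Cartesian_Product.transpose_def C2_def)

lemma tangential_form_C1_hat:
  "tangential_form (C1_hat l1 l c k) v =
     - 2 * (v $ 1)\<^sup>2 + 3 * l1 * (v $ 2)\<^sup>2 + 2 * (c\<^sup>2 - k\<^sup>2) * (v $ 3)\<^sup>2
     - 4 * c * l * v $ 2 * v $ 3"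
  by (simp add: tangential_form_def C1_hat_def sum_3 power2_eq_square algebra_simps)

lemma tangential_form_C2:
  "tangential_form C2 v = (v $ 2)\<^sup>2 - 4 * v $ 1 * v $ 3"
  by (simp add: tangential_form_def C2_def sum_3 power2_eq_square algebra_simps)

theorem theorem3:
  fixes l1 l c k :: complex
  shows "transpose (C1_hat l1 l c k) = C1_hat l1 l c k \<and>
    (\<forall>v. tangential_form (C1_hat l1 l c k) v =
       - 2 * (v $ 1)\<^sup>2 + 3 * l1 * (v $ 2)\<^sup>2 + 2 * (c\<^sup>2 - k\<^sup>2) * (v $ 3)\<^sup>2
       - 4 * c * l * v $ 2 * v $ 3) \<and>
    transpose C2 = C2 \<and>
    (\<forall>v. tangential_form C2 v = (v $ 2)\<^sup>2 - 4 * v $ 1 * v $ 3) \<and>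
    (\<forall>w z x1 x2. darboux_coords z x1 x2 \<longrightarrow>
       (point_form (pencil (C1_hat l1 l c k) C2 w) z = 0 \<longleftrightarrow> kow_Q l1 l c k w x1 x2 = 0)) \<and>
    (\<forall>w z x1 x2. darboux_coords z x1 x2 \<and> z $ 1 = 1 \<longrightarrow>
       z $ 2 = (x1 + x2) / 2 \<and> z $ 3 = x1 * x2 \<and>
       kow_Q l1 l c k w x1 x2 = point_form (pencil (C1_hat l1 l c k) C2 w) z) \<and>
    (\<forall>w x1 x2 z1 z2 z3. z1 = 1 \<and> z2 = (x1 + x2) / 2 \<and> z3 = x1 * x2 \<longrightarrow>
       darboux_coords (vector [z1, z2, z3]) x1 x2 \<and>
       kow_Q l1 l c k w x1 x2 = det (vector
         [vector [0,  z1,      z2,          z3],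
          vector [z1, - 2,     0,           - 2 * w],
          vector [z2, 0,       3 * l1 + w,  - 2 * c * l],
          vector [z3, - 2 * w, - 2 * c * l, 2 * (c\<^sup>2 - k\<^sup>2)]] :: complex^4^4))"
proof (intro conjI allI impI; (elim conjE)?)
  fix w z x1 x2
  assume "darboux_coords z x1 x2"
  then show "point_form (pencil (C1_hat l1 l c k) C2 w) z = 0 \<longleftrightarrow> kow_Q l1 l c k w x1 x2 = 0"
    by (simp add: point_form_pencil) (simp add: darboux_coords_iff)
next
  fix w z x1 x2
  assume "darboux_coords z x1 x2" "z $ 1 = 1"
  then show "z $ 2 = (x1 + x2) / 2" "z $ 3 = x1 * x2"
    "kow_Q l1 l c k w x1 x2 = point_form (pencil (C1_hat l1 l c k) C2 w) z"
    by (simp_all add: point_form_pencil) (simp_all add: darboux_coords_iff)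
next
  fix w x1 x2 z1 z2 z3 :: complex
  assume z: "z1 = 1" "z2 = (x1 + x2) / 2" "z3 = x1 * x2"
  then show darboux: "darboux_coords (vector [z1, z2, z3]) x1 x2"
    by (simp add: darboux_coords_iff)
  \<comment> \<open>The displayed matrix is the bordered matrix of the pencil, entry by entry.\<close>
  show "kow_Q l1 l c k w x1 x2 = det (vector
         [vector [0,  z1,      z2,          z3],
          vector [z1, - 2,     0,           - 2 * w],
          vector [z2, 0,       3 * l1 + w,  - 2 * c * l],
          vector [z3, - 2 * w, - 2 * c * l, 2 * (c\<^sup>2 - k\<^sup>2)]] :: complex^4^4)"
    using point_form_pencil[OF darboux, of l1 l c k w] z(1)
    by (simp add: point_form_def pencil_def C1_hat_def C2_def mult.commute)
qed (simp_all only: transpose_C1_hat transpose_C2 tangential_form_C1_hat tangential_form_C2)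

end
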